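(* Let $x_0=0$ and let $\{x_n\}_{n\in\mathbb{N}}$ be a strictly increasing sequence of positive numbers with $\lim_{n\to+\infty}x_n=+\infty$ and $\inf_{n\in\mathbb{N}}(x_n-x_{n-1})>1$. Let $C$ be the comb domain \[C=\{z\in\mathbb{C}:\mathrm{Re}\, z>-x_1\}\setminus\bigcup_{n\in\mathbb{N}\cup\{0\}}\{x_n+iy: y\in\mathbb{R},\ |y|\ge 1\},\] and set $\alpha_n=x_n-x_{n-1}$ for $n\in\mathbb{N}$. Let $\{b_n\}_{n\in\mathbb{N}}$ be an increasing sequence of positive numbers such that $\inf_{n>1}(b_n-b_{n-1})>0$, and suppose $\alpha_n\le e^{b_n}$ for every $n\in\mathbb{N}$. If \[\lim_{n\to+\infty}\frac{\log\alpha_n}{b_n-b_{n-1}}=+\infty,\] then ${\rm h}(C)=+\infty$.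
   Context: $\mathbb{N}=\{1,2,3,\dots\}$ and $\mathbb{D}$ is the open unit disk in $\mathbb{C}$. For $p>0$, the Hardy space $H^p(\mathbb{D})$ is the set of all holomorphic functions $f$ on $\mathbb{D}$ with $\sup_{0<r<1}\int_0^{2\pi}|f(re^{i\theta})|^p\,d\theta<+\infty$. If $D\ne\mathbb{C}$ is a simply connected domain and $f$ is a Riemann mapping (conformal bijection) from $\mathbb{D}$ onto $D$, the Hardy number of $D$ is ${\rm h}(D)=\sup\{p>0: f\in H^p(\mathbb{D})\}\in[1/2,+\infty]$; it does not depend on the choice of $f$. *)

theory Defs
  imports "HOL-Complex_Analysis.Complex_Analysis"
begin

text \<open>The circle means of a holomorphic function are integrals of continuous functions, so the
  Henstock--Kurzweil integral agrees with the Lebesgue integral here. Finiteness of the supremum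
  over \<open>0 < r < 1\<close> is boundedness from above of the means.\<close>

definition hardy_space :: "real \<Rightarrow> (complex \<Rightarrow> complex) set" where
  "hardy_space p =
     {f. f holomorphic_on ball 0 1 \<and>
         bdd_above ((\<lambda>r. integral {0..2*pi} (\<lambda>\<theta>. norm (f (of_real r * cis \<theta>)) powr p)) ` {0<..<1})}"

definition riemann_map_onto :: "(complex \<Rightarrow> complex) \<Rightarrow> complex set \<Rightarrow> bool" where
  "riemann_map_onto f D \<longleftrightarrow> f holomorphic_on ball 0 1 \<and> bij_betw f (ball 0 1) D"

text \<open>Only meaningful for simply connected domains \<open>D \<noteq> UNIV\<close>, which are the ones admitting a
  Riemann mapping; the value does not depend on the mapping that is chosen.\<close>

definition hardy_number :: "complex set \<Rightarrow> ereal" where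
  "hardy_number D =
     (let f = (SOME f. riemann_map_onto f D) in SUP p\<in>{p. p > 0 \<and> f \<in> hardy_space p}. ereal p)"

definition comb_domain :: "(nat \<Rightarrow> real) \<Rightarrow> complex set" where
  "comb_domain x = {z. Re z > - x 1} - (\<Union>n. {Complex (x n) y | y. \<bar>y\<bar> \<ge> 1})"

end

theory Submission imports Defs
begin

text \<open>To see that a Riemann mapping \<open>f\<close> onto the comb lies in \<open>H\<^sup>p\<close>, it suffices to find a positive
  continuous superharmonic function \<open>U\<close> on the comb with \<open>\<bar>z\<bar>\<^sup>p \<le> c U(z)\<close>: the circle means of \<open>U \<circ> f\<close> are
  at most \<open>U(f(0))\<close>. Put \<open>T\<^sub>n = exp(q b\<^sub>n)\<close> with \<open>q\<close> a large multiple of \<open>p\<close>, and let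
  \<open>G\<^sub>n(z) = T\<^sub>n Re (sqrt(1 + (z - x\<^sub>n)\<^sup>2) + cos((z - x\<^sub>n) / (2 x\<^sub>n\<^sub>+\<^sub>1)))\<close>, which is harmonic on the comb. On the
  strip between the slits at \<open>x\<^sub>n\<^sub>-\<^sub>1\<close> and \<open>x\<^sub>n\<close> take \<open>U = min(G\<^sub>n\<^sub>-\<^sub>1, G\<^sub>n)\<close>. At the gap of the \<open>n\<close>-th slit
  \<open>G\<^sub>n < 3 T\<^sub>n\<close>, while \<open>G\<^sub>n\<^sub>-\<^sub>1\<close> and \<open>G\<^sub>n\<^sub>+\<^sub>1\<close> are at least \<open>\<alpha>\<^sub>n T\<^sub>n\<^sub>-\<^sub>1\<close> and \<open>\<alpha>\<^sub>n\<^sub>+\<^sub>1 T\<^sub>n\<^sub>+\<^sub>1\<close>, so the pieces fit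
  together to a minimum of harmonic functions as soon as \<open>3 T\<^sub>n \<le> \<alpha>\<^sub>n T\<^sub>n\<^sub>-\<^sub>1\<close>. This is what
  \<open>log \<alpha>\<^sub>n / (b\<^sub>n - b\<^sub>n\<^sub>-\<^sub>1) \<rightarrow> \<infinity>\<close> gives for large \<open>n\<close>; the finitely many remaining slits can be ignored.\<close>

section \<open>Superharmonic functions on the disk\<close>

text \<open>A continuous function with this property is superharmonic, but unlike the mean value inequality
  it passes trivially to sums and to compositions with holomorphic maps.\<close>

definition harmonically_supported :: "(complex \<Rightarrow> real) \<Rightarrow> complex set \<Rightarrow> bool" where
  "harmonically_supported W S \<longleftrightarrow> continuous_on S W \<and>
     (\<forall>a\<in>S. \<exists>g e. e > 0 \<and> ball a e \<subseteq> S \<and> g holomorphic_on ball a e \<and> Re (g a) = W a \<and>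
        (\<forall>z\<in>ball a e. W z \<le> Re (g z)))"

section \<open>Stability under minima, sums and holomorphic substitution\<close>

lemma harmonically_supportedD:
  assumes "harmonically_supported W S" "a \<in> S"
  obtains g e where "e > 0" "ball a e \<subseteq> S" "g holomorphic_on ball a e" "Re (g a) = W a"
    "\<And>z. z \<in> ball a e \<Longrightarrow> W z \<le> Re (g z)"
  using assms unfolding harmonically_supported_def by blast

lemma harmonically_supported_continuous:
  "harmonically_supported W S \<Longrightarrow> continuous_on S W"
  by (simp add: harmonically_supported_def)

text \<open>At each point, the function with the smaller real part touches the minimum there and
  dominates it nearby.\<close>

lemma harmonically_supported_min:
  assumes "\<And>a. a \<in> S \<Longrightarrow> \<exists>g h e. e > 0 \<and> ball a e \<subseteq> S \<and> g holomorphic_on ball a e \<and>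
     h holomorphic_on ball a e \<and> (\<forall>z\<in>ball a e. W z = min (Re (g z)) (Re (h z)))"
  shows "harmonically_supported W S"
  unfolding harmonically_supported_def
proof (intro conjI ballI continuous_at_imp_continuous_on)
  fix a assume "a \<in> S"
  from assms[OF this] obtain g h e where e: "e > 0" "ball a e \<subseteq> S" and g: "g holomorphic_on ball a e"
    and h: "h holomorphic_on ball a e" and W: "\<And>z. z \<in> ball a e \<Longrightarrow> W z = min (Re (g z)) (Re (h z))"
    by blast
  have "continuous_on (ball a e) (\<lambda>z. min (Re (g z)) (Re (h z)))"
    by (intro continuous_intros holomorphic_on_imp_continuous_on g h)
  then have "continuous_on (ball a e) W"
    by (rule continuous_on_eq) (use W in simp)
  then show "isCont W a"
    using e by (simp add: continuous_on_eq_continuous_at)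
  define k where "k = (if Re (g a) \<le> Re (h a) then g else h)"
  have "k holomorphic_on ball a e" "Re (k a) = W a" "\<forall>z\<in>ball a e. W z \<le> Re (k z)"
    using g h W e(1) by (auto simp: k_def)
  then show "\<exists>g e. e > 0 \<and> ball a e \<subseteq> S \<and> g holomorphic_on ball a e \<and> Re (g a) = W a \<and>
        (\<forall>z\<in>ball a e. W z \<le> Re (g z))"
    using e by blast
qed

lemma harmonically_supported_zero:
  assumes "open S"
  shows "harmonically_supported (\<lambda>_. 0) S"
  unfolding harmonically_supported_def
proof (intro conjI ballI)
  fix a assume "a \<in> S"
  then obtain e where "e > 0" "ball a e \<subseteq> S"
    using assms open_contains_ball by blast
  then show "\<exists>g e. e > 0 \<and> ball a e \<subseteq> S \<and> g holomorphic_on ball a e \<and> Re (g a) = 0 \<and>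
        (\<forall>z\<in>ball a e. 0 \<le> Re (g z))"
    by (intro exI[of _ "\<lambda>_. 0"] exI[of _ e]) auto
qed auto

lemma harmonically_supported_add:
  assumes V: "harmonically_supported V S" and W: "harmonically_supported W S"
  shows "harmonically_supported (\<lambda>z. V z + W z) S"
  unfolding harmonically_supported_def
proof (intro conjI ballI)
  show "continuous_on S (\<lambda>z. V z + W z)"
    using V W by (intro continuous_intros) (auto simp: harmonically_supported_def)
  fix a assume a: "a \<in> S"
  obtain g d where g: "d > 0" "ball a d \<subseteq> S" "g holomorphic_on ball a d" "Re (g a) = V a"
    "\<And>z. z \<in> ball a d \<Longrightarrow> V z \<le> Re (g z)"
    by (rule harmonically_supportedD[OF V a]) blast
  obtain h e where h: "e > 0" "ball a e \<subseteq> S" "h holomorphic_on ball a e" "Re (h a) = W a"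
    "\<And>z. z \<in> ball a e \<Longrightarrow> W z \<le> Re (h z)"
    by (rule harmonically_supportedD[OF W a]) blast
  have "ball a (min d e) \<subseteq> ball a d" "ball a (min d e) \<subseteq> ball a e"
    by auto
  then have "(\<lambda>z. g z + h z) holomorphic_on ball a (min d e)"
    using g(3) h(3) by (intro holomorphic_intros) (auto intro: holomorphic_on_subset)
  moreover have "V z + W z \<le> Re (g z + h z)" if "z \<in> ball a (min d e)" for z
    using g(5)[of z] h(5)[of z] that by simp
  ultimately show "\<exists>g e. e > 0 \<and> ball a e \<subseteq> S \<and> g holomorphic_on ball a e \<and> Re (g a) = V a + W a \<and>
        (\<forall>z\<in>ball a e. V z + W z \<le> Re (g z))"
    using g h by (intro exI[of _ "\<lambda>z. g z + h z"] exI[of _ "min d e"]) auto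
qed

lemma harmonically_supported_sum:
  assumes "open S" "finite K" "\<And>k. k \<in> K \<Longrightarrow> harmonically_supported (W k) S"
  shows "harmonically_supported (\<lambda>z. \<Sum>k\<in>K. W k z) S"
  using assms(2,3)
proof (induction K rule: finite_induct)
  case empty
  then show ?case
    using harmonically_supported_zero[OF \<open>open S\<close>] by simp
next
  case (insert k K)
  then show ?case
    using harmonically_supported_add[of "W k" S "\<lambda>z. \<Sum>k\<in>K. W k z"] by simp
qed

lemma harmonically_supported_compose:
  assumes W: "harmonically_supported W S" and f: "f holomorphic_on R" and "open R" and "f ` R \<subseteq> S"
  shows "harmonically_supported (\<lambda>z. W (f z)) R"
  unfolding harmonically_supported_def
proof (intro conjI ballI)
  have cf: "continuous_on R f"
    using f holomorphic_on_imp_continuous_on by blast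
  then show "continuous_on R (\<lambda>z. W (f z))"
    using W assms(4) continuous_on_compose2 unfolding harmonically_supported_def by blast
  fix a assume a: "a \<in> R"
  then have "f a \<in> S"
    using assms(4) by blast
  then obtain g e where g: "e > 0" "ball (f a) e \<subseteq> S" "g holomorphic_on ball (f a) e"
    "Re (g (f a)) = W (f a)" "\<And>z. z \<in> ball (f a) e \<Longrightarrow> W z \<le> Re (g z)"
    by (rule harmonically_supportedD[OF W]) blast
  have "open (R \<inter> f -` ball (f a) e)"
    using cf \<open>open R\<close> continuous_open_preimage by blast
  moreover have "a \<in> R \<inter> f -` ball (f a) e"
    using a g by simp
  ultimately obtain d where d: "d > 0" "ball a d \<subseteq> R \<inter> f -` ball (f a) e"
    by (meson open_contains_ball)
  have "(g \<circ> f) holomorphic_on ball a d"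
  proof (rule holomorphic_on_compose_gen)
    show "f holomorphic_on ball a d"
      using d f holomorphic_on_subset by blast
  qed (use d g in auto)
  moreover have "\<forall>z\<in>ball a d. W (f z) \<le> Re ((g \<circ> f) z)"
    using d g by auto
  ultimately show "\<exists>g e. e > 0 \<and> ball a e \<subseteq> R \<and> g holomorphic_on ball a e \<and> Re (g a) = W (f a) \<and>
        (\<forall>z\<in>ball a e. W (f z) \<le> Re (g z))"
    using d g by (intro exI[of _ "g \<circ> f"] exI[of _ d]) auto
qed

section \<open>Minimum principle\<close>

lemma harmonically_supported_local_min:
  assumes W: "harmonically_supported W S" and "a \<in> S" and e: "e > 0" and min: "\<And>z. z \<in> ball a e \<Longrightarrow> W a \<le> W z"
  obtains d where "d > 0" "\<And>z. z \<in> ball a d \<Longrightarrow> W z = W a"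
proof -
  obtain g r where g: "r > 0" "ball a r \<subseteq> S" "g holomorphic_on ball a r" "Re (g a) = W a"
    "\<And>z. z \<in> ball a r \<Longrightarrow> W z \<le> Re (g z)"
    by (rule harmonically_supportedD[OF W \<open>a \<in> S\<close>]) blast
  define d where "d = min e r"
  have sub: "ball a d \<subseteq> ball a r" "ball a d \<subseteq> ball a e" and "d > 0"
    using g e by (auto simp: d_def)
  \<comment> \<open>\<open>norm (h z) = exp (- Re (g z))\<close>, and
    \<open>W a \<le> W z \<le> Re (g z)\<close> makes it maximal at \<open>a\<close>. By the maximum
    modulus principle \<open>h\<close> is constant, so \<open>W\<close> is squeezed to
    \<open>W a\<close>.\<close>
  define h where "h = (\<lambda>z. exp (- g z))"
  have hol: "h holomorphic_on ball a d"
    unfolding h_def by (intro holomorphic_intros holomorphic_on_subset[OF g(3) sub(1)])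
  have le: "norm (h z) \<le> norm (h a)" if "z \<in> ball a d" for z
  proof -
    have "W a \<le> W z" "W z \<le> Re (g z)"
      using that sub min g(5) by auto
    then show ?thesis
      using g(4) by (simp add: h_def)
  qed
  have "h constant_on ball a d"
    by (rule maximum_modulus_principle[OF hol _ _ _ order_refl _ le]) (use \<open>d > 0\<close> in auto)
  then have const: "h z = h a" if "z \<in> ball a d" for z
    using that \<open>d > 0\<close> unfolding constant_on_def by (metis centre_in_ball)
  have "W z = W a" if z: "z \<in> ball a d" for z
  proof -
    have "norm (h z) = norm (h a)"
      using const[OF z] by simp
    then have "Re (g z) = W a"
      using g(4) by (simp add: h_def)
    moreover have "W a \<le> W z" "W z \<le> Re (g z)"
      using z sub min g(5) by auto
    ultimately show ?thesis by simp
  qed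
  with \<open>d > 0\<close> that show thesis by blast
qed

text \<open>Among the minimum points in the closed disk take one farthest from 0. If it were
  interior, \<open>W\<close> would be constant near it, giving minimum points still farther
  out.\<close>

lemma harmonically_supported_minimum_principle:
  assumes W: "harmonically_supported W (ball 0 1)" and r: "0 < r" "r < 1"
  obtains z where "norm z = r" "W z \<le> W 0"
proof -
  have sub: "cball 0 r \<subseteq> (ball 0 1 :: complex set)"
    using r by auto
  then have cont: "continuous_on (cball 0 r) W"
    using harmonically_supported_continuous[OF W] continuous_on_subset by blast
  then obtain m where m: "m \<in> cball 0 r" "\<And>z. z \<in> cball 0 r \<Longrightarrow> W m \<le> W z"
  proof -
    have "cball 0 r \<noteq> ({} :: complex set)"
      using r by simp
    then show thesis
      using continuous_attains_inf[OF compact_cball _ cont] that by blast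
  qed
  define K where "K = {z \<in> cball 0 r. W z = W m}"
  have "closed K"
    unfolding K_def by (rule continuous_closed_preimage_constant[OF cont]) simp
  then have "compact K"
    by (auto simp: compact_eq_bounded_closed K_def intro: bounded_subset[OF bounded_cball[of 0 r]])
  moreover have "m \<in> K"
    using m by (simp add: K_def)
  ultimately obtain a where a: "a \<in> K" "\<And>z. z \<in> K \<Longrightarrow> norm z \<le> norm a"
    using continuous_attains_sup[of K norm] continuous_on_norm_id[of K] by blast
  have Wa: "W a = W m" and ar: "norm a \<le> r"
    using a by (auto simp: K_def)
  have "norm a = r"
  proof (rule ccontr)
    assume "norm a \<noteq> r"
    with ar have lt: "norm a < r" by simp
    have in_cball: "z \<in> cball 0 r" if "z \<in> ball a (r - norm a)" for z
    proof -
      have "norm z \<le> norm a + norm (z - a)"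
        using norm_triangle_sub by blast
      then show ?thesis
        using that by (simp add: dist_norm norm_minus_commute)
    qed
    obtain d where d: "d > 0" "\<And>z. z \<in> ball a d \<Longrightarrow> W z = W a"
    proof (rule harmonically_supported_local_min[OF W, of a "r - norm a"])
      show "a \<in> ball 0 1" "r - norm a > 0"
        using lt r by auto
      show "W a \<le> W z" if "z \<in> ball a (r - norm a)" for z
        using m(2)[OF in_cball[OF that]] Wa by simp
    qed (blast intro: that)
    define s where "s = min d (r - norm a) / 2"
    have s: "s > 0" "s < d" "s < r - norm a"
      using d lt by (auto simp: s_def)
    \<comment> \<open>The outward radial direction at \<open>a\<close>; at the centre any unit
      vector serves.\<close>
    define u where "u = (if a = 0 then 1 else sgn a)"
    have u: "norm u = 1" "norm a *\<^sub>R u = a"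
      by (auto simp: u_def norm_sgn sgn_div_norm)
    define z where "z = (norm a + s) *\<^sub>R u"
    have "z - a = s *\<^sub>R u"
      using u(2) by (simp add: z_def scaleR_add_left)
    then have "dist a z = s"
      using u(1) s by (simp add: dist_norm norm_minus_commute[of a])
    then have "z \<in> ball a d" "z \<in> ball a (r - norm a)"
      using s by auto
    then have "z \<in> K"
      using d(2) in_cball Wa by (auto simp: K_def)
    moreover have "norm z = norm a + s"
      using u(1) s by (simp add: z_def)
    ultimately show False
      using a(2)[of z] s by simp
  qed
  moreover have "W a \<le> W 0"
    using Wa m(2)[of 0] r by simp
  ultimately show thesis
    using that by blast
qed

section \<open>Circle means through Riemann sums\<close>

lemma integral_le_riemann_sum:
  fixes h :: "real \<Rightarrow> real"
  assumes cont: "continuous_on UNIV h" and d: "d \<ge> 0"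
    and osc: "\<And>s t. \<bar>s - t\<bar> \<le> d \<Longrightarrow> \<bar>h s - h t\<bar> \<le> e"
  shows "integral {a..a + real n * d} h \<le> (\<Sum>k<n. d * (h (a + real k * d) + e))"
proof (induction n)
  case (Suc n)
  let ?b = "a + real n * d"
  have int: "h integrable_on {s..t}" for s t
    by (rule integrable_continuous_interval) (use cont continuous_on_subset in blast)
  have eq: "a + real (Suc n) * d = ?b + d"
    by (simp add: algebra_simps)
  have "integral {a..a + real (Suc n) * d} h = integral {a..?b} h + integral {?b..?b + d} h"
    unfolding eq by (rule Henstock_Kurzweil_Integration.integral_combine[symmetric, OF _ _ int]) (use d in auto)
  also have "integral {?b..?b + d} h \<le> integral {?b..?b + d} (\<lambda>_. h ?b + e)"
  proof (rule integral_le[OF int])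
    show "h t \<le> h ?b + e" if "t \<in> {?b..?b + d}" for t
      using osc[of t ?b] that by auto
  qed auto
  also have "\<dots> = d * (h ?b + e)"
    using d by simp
  finally show ?case
    using Suc.IH by simp
qed auto

lemma integral_periodic_shift:
  fixes h :: "real \<Rightarrow> real"
  assumes cont: "continuous_on UNIV h" and per: "\<And>t. h (t + c) = h t" and "c \<ge> 0" "a \<ge> 0"
  shows "integral {a..a + c} h = integral {0..c} h"
proof -
  have int: "h integrable_on {s..t}" for s t
    by (rule integrable_continuous_interval) (use cont continuous_on_subset in blast)
  have "integral {0..a} h + integral {a..a + c} h = integral {0..a + c} h"
    by (rule Henstock_Kurzweil_Integration.integral_combine[OF _ _ int]) (use assms in auto)
  moreover have "integral {0..c} h + integral {c..a + c} h = integral {0..a + c} h"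
    by (rule Henstock_Kurzweil_Integration.integral_combine[OF _ _ int]) (use assms in auto)
  moreover have "integral {c..a + c} h = integral {0..a} h"
  proof -
    have "integral {0 + c..a + c} h = integral {0..a} (h \<circ> (+) c)"
      by (rule integral_shift_Icc_real[symmetric])
    also have "h \<circ> (+) c = h"
      using per by (auto simp: add.commute)
    finally show ?thesis by simp
  qed
  ultimately show ?thesis by simp
qed


text \<open>The sum of the rotates of \<open>W\<close> by the \<open>n\<close>-th roots of unity inherits the minimum principle,
  so that \<open>n W(0)\<close> bounds some Riemann sum of \<open>W\<close> over the circle.\<close>

lemma harmonically_supported_circle_mean:
  assumes W: "harmonically_supported W (ball 0 1)" and r: "0 < r" "r < 1"
  shows "integral {0..2*pi} (\<lambda>\<theta>. W (of_real r * cis \<theta>)) \<le> 2 * pi * W 0"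
proof (rule field_le_epsilon)
  fix \<epsilon> :: real assume "\<epsilon> > 0"
  \<comment> \<open>Error per unit length, adding up to \<open>\<epsilon>\<close> over a
    period.\<close>
  define e where "e = \<epsilon> / (2 * pi)"
  have "e > 0"
    using \<open>\<epsilon> > 0\<close> by (simp add: e_def)
  define h where "h \<theta> = W (of_real r * cis \<theta>)" for \<theta>
  have Wcont: "continuous_on (cball 0 r) W"
    by (rule continuous_on_subset[OF harmonically_supported_continuous[OF W]]) (use r in auto)
  have hcont: "continuous_on UNIV h"
    unfolding h_def
    by (rule continuous_on_compose2[OF Wcont])
      (use r in \<open>auto intro!: continuous_intros continuous_on_cis simp: norm_mult\<close>)
  have per: "h (\<theta> + 2 * pi) = h \<theta>" for \<theta>
    by (simp add: h_def cis.ctr)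
  have "uniformly_continuous_on (cball 0 r) W"
    by (rule compact_uniformly_continuous[OF Wcont]) simp
  then obtain d where d: "d > 0"
    "\<And>z w. z \<in> cball 0 r \<Longrightarrow> w \<in> cball 0 r \<Longrightarrow> dist w z < d \<Longrightarrow> dist (W w) (W z) < e"
    unfolding uniformly_continuous_on_def using \<open>e > 0\<close> by metis
  obtain n :: nat where n: "n > 0" "2 * pi / real n < d"
  proof -
    obtain n :: nat where n: "2 * pi / d < real n"
      using reals_Archimedean2 by blast
    have "0 < 2 * pi / d" using d by simp
    with n have "n > 0" using of_nat_0_less_iff by (metis order.strict_trans)
    moreover have "2 * pi / real n < d"
      using n d \<open>n > 0\<close> by (simp add: field_simps)
    ultimately show thesis using that by blast
  qed
  define \<delta> where "\<delta> = 2 * pi / real n"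
  have \<delta>: "\<delta> > 0" "real n * \<delta> = 2 * pi" "\<delta> < d"
    using n by (auto simp: \<delta>_def)
  have osc: "\<bar>h s - h t\<bar> \<le> e" if "\<bar>s - t\<bar> \<le> \<delta>" for s t
  proof -
    have "dist (of_real r * cis s) (of_real r * cis t) = r * norm (cis s - cis t)"
      using r by (simp add: dist_norm norm_mult flip: right_diff_distrib)
    \<comment> \<open>A chord is no longer than its arc, so a mesh below \<open>d\<close> is fine
      enough for the uniform continuity of \<open>W\<close>.\<close>
    also have "norm (cis s - cis t) \<le> \<bar>s - t\<bar>"
    proof -
      have "cis s - cis t = cis t * (exp (\<i> * of_real (s - t)) - 1)"
        by (simp add: cis_conv_exp algebra_simps flip: exp_add)
      then have "norm (cis s - cis t) = norm (exp (\<i> * of_real (s - t)) - 1)"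
        by (simp add: norm_mult)
      also have "\<dots> = 2 * \<bar>sin ((s - t) / 2)\<bar>"
        by (rule dist_exp_i_1)
      also have "\<dots> \<le> 2 * \<bar>(s - t) / 2\<bar>"
        by (intro mult_left_mono abs_sin_x_le_abs_x) simp
      finally show ?thesis by simp
    qed
    also have "r * \<bar>s - t\<bar> \<le> 1 * \<bar>s - t\<bar>"
      using r by (intro mult_right_mono) auto
    finally have "dist (of_real r * cis s) (of_real r * cis t) < d"
      using that \<delta> r by simp
    then have "dist (W (of_real r * cis s)) (W (of_real r * cis t)) < e"
      using r by (intro d) (auto simp: norm_mult)
    then show ?thesis
      by (simp add: h_def dist_real_def)
  qed
  have "harmonically_supported (\<lambda>z. \<Sum>k<n. W (cis (real k * \<delta>) * z)) (ball 0 1)"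
    by (intro harmonically_supported_sum harmonically_supported_compose[OF W] holomorphic_intros)
      (auto simp: norm_mult)
  then obtain z where z: "norm z = r"
    "(\<Sum>k<n. W (cis (real k * \<delta>) * z)) \<le> (\<Sum>k<n. W (cis (real k * \<delta>) * 0))"
    using harmonically_supported_minimum_principle[OF _ r] by blast
  \<comment> \<open>Starting the Riemann sum at the argument of \<open>z\<close> makes its nodes the
    rotates of \<open>z\<close>. \<open>Arg2pi\<close> supplies \<open>a \<ge> 0\<close>, as the
    periodic shift requires.\<close>
  define a where "a = Arg2pi z"
  have a: "a \<ge> 0" "z = of_real r * cis a"
    using z(1) Arg2pi[of z] by (auto simp: a_def cis_conv_exp is_Arg_def)
  have "cis (real k * \<delta>) * z = of_real r * cis (a + real k * \<delta>)" for k
    by (simp add: a(2) cis_mult[symmetric])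
  then have sum: "(\<Sum>k<n. h (a + real k * \<delta>)) \<le> real n * W 0"
    using z(2) by (simp add: h_def)
  have "integral {0..2*pi} h = integral {a..a + real n * \<delta>} h"
    using integral_periodic_shift[OF hcont per _ a(1)] \<delta> by simp
  also have "\<dots> \<le> (\<Sum>k<n. \<delta> * (h (a + real k * \<delta>) + e))"
    by (rule integral_le_riemann_sum[OF hcont _ osc]) (use \<delta> in auto)
  also have "\<dots> = \<delta> * (\<Sum>k<n. h (a + real k * \<delta>)) + real n * \<delta> * e"
    by (simp add: sum.distrib sum_distrib_left algebra_simps)
  also have "\<dots> \<le> \<delta> * (real n * W 0) + real n * \<delta> * e"
    using sum \<delta> by (intro add_mono mult_left_mono) auto
  also have "\<dots> = 2 * pi * W 0 + \<epsilon>"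
    using \<delta>(2) by (simp add: e_def algebra_simps)
  finally show "integral {0..2*pi} (\<lambda>\<theta>. W (of_real r * cis \<theta>)) \<le> 2 * pi * W 0 + \<epsilon>"
    by (simp add: h_def[abs_def])
qed

text \<open>The means of \<open>U \<circ> f\<close> are at most \<open>2 * pi * U (f 0)\<close>, a
  bound independent of the radius.\<close>

lemma in_hardy_spaceI:
  assumes f: "f holomorphic_on ball 0 1" "f ` ball 0 1 \<subseteq> S" and U: "harmonically_supported U S"
    and p: "p > 0" and le: "\<And>z. z \<in> S \<Longrightarrow> norm z powr p \<le> c * U z"
    and c: "c > 0"
  shows "f \<in> hardy_space p"
proof -
  define W where "W = (\<lambda>z. U (f z))"
  have W: "harmonically_supported W (ball 0 1)"
    unfolding W_def using harmonically_supported_compose[OF U f(1) _ f(2)] by simp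
  have "integral {0..2*pi} (\<lambda>\<theta>. norm (f (of_real r * cis \<theta>)) powr p) \<le> c * (2 * pi * W 0)"
    if r: "0 < r" "r < 1" for r
  proof -
    have in_ball: "of_real r * cis \<theta> \<in> ball 0 1" for \<theta>
      using r by (simp add: norm_mult)
    have cont: "continuous_on {0..2*pi} (\<lambda>\<theta>. G (of_real r * cis \<theta>))"
      if "continuous_on (ball 0 1) G" for G :: "complex \<Rightarrow> 'b::topological_space"
      by (rule continuous_on_compose2[OF that])
        (use in_ball in \<open>auto intro!: continuous_intros continuous_on_cis\<close>)
    have "continuous_on (ball 0 1) (\<lambda>z. norm (f z) powr p)"
      using holomorphic_on_imp_continuous_on[OF f(1)] p
      by (intro continuous_on_powr' continuous_intros) auto
    moreover have "(\<lambda>\<theta>. norm (f (of_real r * cis \<theta>)) powr p) integrable_on {0..2*pi}"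
      by (intro integrable_continuous_interval cont[of "\<lambda>z. norm (f z) powr p"] calculation)
    moreover have "(\<lambda>\<theta>. c * W (of_real r * cis \<theta>)) integrable_on {0..2*pi}"
      by (intro integrable_continuous_interval cont[of "\<lambda>z. c * W z"] continuous_intros
          harmonically_supported_continuous[OF W])
    moreover have "norm (f (of_real r * cis \<theta>)) powr p \<le> c * W (of_real r * cis \<theta>)" for \<theta>
      unfolding W_def using le f(2) in_ball by blast
    ultimately have "integral {0..2*pi} (\<lambda>\<theta>. norm (f (of_real r * cis \<theta>)) powr p)
      \<le> integral {0..2*pi} (\<lambda>\<theta>. c * W (of_real r * cis \<theta>))"
      by (intro integral_le) auto
    also have "\<dots> = c * integral {0..2*pi} (\<lambda>\<theta>. W (of_real r * cis \<theta>))"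
      by simp
    also have "\<dots> \<le> c * (2 * pi * W 0)"
      using c by (intro mult_left_mono harmonically_supported_circle_mean[OF W r]) auto
    finally show ?thesis .
  qed
  then show ?thesis
    using f(1) unfolding hardy_space_def by (auto intro!: bdd_aboveI2)
qed

section \<open>Comb domains and the Hardy number\<close>

lemma mem_comb_domain:
  "z \<in> comb_domain x \<longleftrightarrow> Re z > - x 1 \<and> (\<forall>n. Re z = x n \<longrightarrow> \<bar>Im z\<bar> < 1)"
  by (auto simp: comb_domain_def complex_eq_iff not_le)

text \<open>Since \<open>x\<close> tends to infinity, only finitely many slits meet the half-plane
  \<open>Re z < Re a + 1\<close>, and a finite union of closed slits is closed.\<close>

lemma open_comb_domain:
  assumes "filterlim x at_top sequentially"
  shows "open (comb_domain x)"
proof -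
  define S where "S n = {z. Re z = x n \<and> \<bar>Im z\<bar> \<ge> 1}" for n
  have op: "open {z. Re z > - x 1 \<and> Re z < c \<and> z \<notin> (\<Union>n<M. S n)}" for c M
  proof -
    have "closed (S n)" for n
      unfolding S_def by (intro closed_Collect_conj closed_Collect_eq closed_Collect_le continuous_intros)
    then have "closed (\<Union>n<M. S n)"
      by (intro closed_UN) auto
    then have "open (- (\<Union>n<M. S n))"
      by (rule open_Compl)
    moreover have "open ({z. Re z > - x 1} \<inter> {z. Re z < c})"
      by (intro open_Int open_Collect_less continuous_intros)
    ultimately have "open ({z. Re z > - x 1} \<inter> {z. Re z < c} \<inter> - (\<Union>n<M. S n))"
      by (rule open_Int[rotated])
    also have "\<dots> = {z. Re z > - x 1 \<and> Re z < c \<and> z \<notin> (\<Union>n<M. S n)}"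
      by auto
    finally show ?thesis .
  qed
  show ?thesis
  proof (subst open_subopen, intro ballI)
    fix a assume a: "a \<in> comb_domain x"
    obtain M where M: "\<And>n. n \<ge> M \<Longrightarrow> Re a + 1 \<le> x n"
      using assms unfolding filterlim_at_top eventually_sequentially by blast
    let ?A = "{z. Re z > - x 1 \<and> Re z < Re a + 1 \<and> z \<notin> (\<Union>n<M. S n)}"
    have "a \<in> ?A"
      using a by (auto simp: mem_comb_domain S_def)
    moreover have "?A \<subseteq> comb_domain x"
    proof
      fix z assume z: "z \<in> ?A"
      have "\<bar>Im z\<bar> < 1" if "Re z = x n" for n
      proof (cases "n < M")
        case True
        then show ?thesis
          using z that by (auto simp: S_def)
      next
        case False
        then show ?thesis
          using M[of n] z that by auto
      qed
      then show "z \<in> comb_domain x"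
        using z by (auto simp: mem_comb_domain)
    qed
    ultimately show "\<exists>T. open T \<and> a \<in> T \<and> T \<subseteq> comb_domain x"
      using op by blast
  qed
qed

text \<open>Project vertically to the real axis, which fixes \<open>Re z\<close> and shrinks
  \<open>\<bar>Im z\<bar>\<close>, then contract the axis to 0.\<close>

lemma contractible_comb_domain:
  assumes "x 1 > 0"
  shows "contractible (comb_domain x)"
proof -
  let ?C = "comb_domain x"
  have "homotopic_with_canon (\<lambda>z. True) ?C ?C id (\<lambda>z. of_real (Re z))"
  proof (rule homotopic_with_linear)
    fix z assume z: "z \<in> ?C"
    show "closed_segment (id z) (of_real (Re z)) \<subseteq> ?C"
    proof
      fix w assume "w \<in> closed_segment (id z) (of_real (Re z))"
      then obtain u where u: "0 \<le> u" "u \<le> 1" "w = (1 - u) *\<^sub>R z + u *\<^sub>R of_real (Re z)"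
        by (auto simp: in_segment)
      have "Re w = Re z"
        unfolding u(3) by (simp add: algebra_simps)
      moreover have "\<bar>Im w\<bar> \<le> \<bar>Im z\<bar>"
        using u by (simp add: abs_mult mult_left_le_one_le)
      ultimately show "w \<in> ?C"
        using z by (fastforce simp: mem_comb_domain)
    qed
  qed (auto intro!: continuous_intros)
  moreover have "homotopic_with_canon (\<lambda>z. True) ?C ?C (\<lambda>z. of_real (Re z)) (\<lambda>z. 0)"
  proof (rule homotopic_with_linear)
    fix z assume z: "z \<in> ?C"
    show "closed_segment (complex_of_real (Re z)) 0 \<subseteq> ?C"
    proof
      fix w assume "w \<in> closed_segment (complex_of_real (Re z)) 0"
      then obtain u where u: "0 \<le> u" "u \<le> 1" "w = (1 - u) *\<^sub>R of_real (Re z)"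
        by (auto simp: in_segment)
      have "Re w > - x 1"
      proof (cases "Re z \<ge> 0")
        case True
        then have "Re w \<ge> 0"
          using u by simp
        then show ?thesis
          using assms by simp
      next
        case False
        then have "(1 - u) * Re z \<ge> 1 * Re z"
          using u by (intro mult_right_mono_neg) auto
        then show ?thesis
          using u z by (simp add: mem_comb_domain)
      qed
      then show "w \<in> ?C"
        using u by (simp add: mem_comb_domain)
    qed
  qed (auto intro!: continuous_intros)
  ultimately have "homotopic_with_canon (\<lambda>z. True) ?C ?C id (\<lambda>z. 0)"
    by (rule homotopic_with_trans)
  then show ?thesis
    unfolding contractible_def by blast
qed

lemma riemann_map_onto_exists:
  assumes "open D" "simply_connected D" "D \<noteq> {}" "D \<noteq> UNIV"
  shows "\<exists>f. riemann_map_onto f D"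
proof -
  obtain f g where g: "g holomorphic_on ball 0 1"
    "\<forall>z\<in>D. f z \<in> ball 0 1 \<and> g (f z) = z" "\<forall>z\<in>ball 0 1. g z \<in> D \<and> f (g z) = z"
    using Riemann_mapping_theorem[of D] assms by auto
  have "bij_betw g (ball 0 1) D"
    by (rule bij_betw_byWitness[of _ f]) (use g in auto)
  then show ?thesis
    using g(1) unfolding riemann_map_onto_def by blast
qed

text \<open>The Hardy number refers to an arbitrarily chosen Riemann mapping, so membership is
  demanded for all of them, and existence makes the choice a genuine one.\<close>

lemma hardy_number_eq_infinity:
  assumes ex: "\<exists>f. riemann_map_onto f D"
    and hardy: "\<And>f p. riemann_map_onto f D \<Longrightarrow> p > 0 \<Longrightarrow> f \<in> hardy_space p"
  shows "hardy_number D = \<infinity>"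
proof -
  define f where "f = (SOME f. riemann_map_onto f D)"
  have "riemann_map_onto f D"
    unfolding f_def using ex by (rule someI_ex)
  then have "{p. p > 0 \<and> f \<in> hardy_space p} = {0<..}"
    using hardy by auto
  then have "hardy_number D = (SUP p\<in>{0<..}. ereal p)"
    by (simp add: hardy_number_def f_def Let_def)
  also have "\<dots> = \<infinity>"
  proof (rule SUP_PInfty)
    show "\<exists>p\<in>{0<..}. ereal (real n) \<le> ereal p" for n
      by (rule bexI[of _ "real n + 1"]) auto
  qed
  finally show ?thesis .
qed

section \<open>The superharmonic majorant\<close>

lemma csqrt_one_plus_square_ge: "\<bar>Re w\<bar> \<le> Re (csqrt (1 + w\<^sup>2))"
proof (rule ccontr)
  define u where "u = csqrt (1 + w\<^sup>2)"
  assume "\<not> ?thesis"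
  then have lt: "Re u < \<bar>Re w\<bar>"
    by (simp add: u_def)
  have pos: "Re u \<ge> 0"
    unfolding u_def by (rule Re_csqrt)
  have sq: "u\<^sup>2 = 1 + w\<^sup>2"
    by (simp add: u_def)
  \<comment> \<open>If \<open>Re u\<close> is too small, the equal products in \<open>im\<close>
    force \<open>(Im w)\<^sup>2 \<le> (Im u)\<^sup>2\<close>; then the left side of
    \<open>re\<close> is below the right.\<close>
  have re: "(Re u)\<^sup>2 - (Im u)\<^sup>2 = 1 + (Re w)\<^sup>2 - (Im w)\<^sup>2"
    using arg_cong[OF sq, of Re] by (simp add: Re_power2)
  have im: "Re u * Im u = Re w * Im w"
    using arg_cong[OF sq, of Im] by (simp add: Im_power2)
  have less: "(Re u)\<^sup>2 < (Re w)\<^sup>2"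
    using lt pos by (metis abs_of_nonneg power2_abs power_strict_mono zero_less_numeral)
  have "(Im w)\<^sup>2 \<le> (Im u)\<^sup>2"
  proof (rule ccontr)
    assume "\<not> ?thesis"
    then have "(Im u)\<^sup>2 < (Im w)\<^sup>2" by simp
    then have "(Re u)\<^sup>2 * (Im u)\<^sup>2 < (Re w)\<^sup>2 * (Im w)\<^sup>2"
      using less by (intro mult_strict_mono) (auto intro: le_less_trans[of 0])
    then show False
      using im by (metis order_less_irrefl power_mult_distrib)
  qed
  with re less show False by simp
qed

lemma cos_ge_half:
  fixes t :: real
  assumes "\<bar>t\<bar> \<le> 1"
  shows "cos t \<ge> 1/2"
proof -
  have "cos (pi/3) \<le> cos \<bar>t\<bar>"
    using assms pi_gt3 by (intro cos_monotone_0_pi_le) auto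
  then show ?thesis
    by (simp add: cos_60)
qed

text \<open>Raise \<open>1 + t \<le> max 1 p * (1 + t / p) \<le> max 1 p * exp (t / p)\<close> to
  the power \<open>p\<close>. Exponential growth in \<open>\<bar>Im z\<bar>\<close> thereby pays for
  the power of the norm.\<close>

lemma one_plus_powr_le_exp:
  fixes p t :: real
  assumes "p > 0" "t \<ge> 0"
  shows "(1 + t) powr p \<le> max 1 p powr p * exp t"
proof -
  have "1 + t \<le> max 1 p * (1 + t / p)"
  proof -
    have "max 1 p * (1 + t / p) = max 1 p + (max 1 p / p) * t"
      by (simp add: algebra_simps)
    moreover have "1 * t \<le> (max 1 p / p) * t"
      using assms by (intro mult_right_mono) (auto simp: field_simps)
    ultimately show ?thesis by simp
  qed
  also have "\<dots> \<le> max 1 p * exp (t / p)"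
    by (intro mult_left_mono exp_ge_add_one_self) auto
  finally have "(1 + t) powr p \<le> (max 1 p * exp (t / p)) powr p"
    using assms by (intro powr_mono2) auto
  also have "\<dots> = max 1 p powr p * exp t"
    using assms by (simp add: powr_mult exp_powr_real)
  finally show ?thesis .
qed

text \<open>The constant 3 bounds \<open>gate n / T n\<close> in the gap of slit \<open>n\<close>.
  The last two assumptions say that there both neighbouring gates, bounded below by weight times
  distance, are larger.\<close>

locale comb_weights =
  fixes x T :: "nat \<Rightarrow> real" and N :: nat
  assumes mono: "strict_mono x" and x_0: "x 0 = 0" and x_1: "x 1 \<ge> 1"
    and lim: "filterlim x at_top sequentially"
    and T_pos: "\<And>n. T n > 0"
    and T_up: "\<And>n. n \<ge> N \<Longrightarrow> 3 * T (Suc n) \<le> T n * (x (Suc n) - x n)"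
    and T_down: "\<And>n. n \<ge> N \<Longrightarrow> 3 * T n \<le> T (Suc n) * (x (Suc n) - x n)"
begin

text \<open>\<open>gate n\<close> has size about \<open>T n\<close> in the gap of the \<open>n\<close>-th slit: the square root
  makes it grow linearly in the distance to the slit line, so that it exceeds the neighbouring gate functions
  at their own gaps, and the cosine makes it grow exponentially in \<open>\<bar>Im z\<bar>\<close>.\<close>

definition gate :: "nat \<Rightarrow> complex \<Rightarrow> complex" where
  "gate n z = of_real (T n) *
     (csqrt (1 + (z - of_real (x n))\<^sup>2) + cos ((z - of_real (x n)) / of_real (2 * x (Suc n))))"

text \<open>The index of the slit bounding the strip of \<open>z\<close> on the right: 0 left of the
  imaginary axis, and \<open>Suc n\<close> when \<open>Re z = x n\<close>.\<close>

definition idx :: "complex \<Rightarrow> nat" where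
  "idx z = (LEAST n. Re z < x n)"

text \<open>Near the gap of slit \<open>n\<close> only \<open>gate n\<close> attains the minimum, so passing from one strip to the next
  keeps \<open>majorant\<close> continuous. The slits with index below \<open>N\<close> are ignored.\<close>

definition majorant :: "complex \<Rightarrow> real" where
  "majorant z = (if idx z \<le> N then Re (gate N z)
     else min (Re (gate (idx z - 1) z)) (Re (gate (idx z) z)))"

lemma x_Suc_ge_1: "x (Suc n) \<ge> 1"
  using x_1 strict_mono_mono[OF mono] by (simp add: mono_def) (metis One_nat_def Suc_le_mono le0 order_trans)

lemma x_nonneg: "x n \<ge> 0"
  using x_0 strict_mono_mono[OF mono] unfolding mono_def by (metis le0)

lemma idx_less: "Re z < x (idx z)"
proof -
  obtain n where "Re z + 1 \<le> x n"
    using lim unfolding filterlim_at_top eventually_sequentially by blast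
  then have "Re z < x n" by simp
  then show ?thesis
    unfolding idx_def by (rule LeastI)
qed

lemma idx_eqI:
  assumes "Re z < x n" "n = 0 \<or> x (n - 1) \<le> Re z"
  shows "idx z = n"
  unfolding idx_def
proof (rule Least_equality)
  fix m assume "Re z < x m"
  show "n \<le> m"
  proof (rule ccontr)
    assume "\<not> n \<le> m"
    then have "x m \<le> x (n - 1)" "n \<noteq> 0"
      by (auto intro!: monoD[OF strict_mono_mono[OF mono]])
    then show False
      using assms \<open>Re z < x m\<close> by simp
  qed
qed fact

lemma idx_ge: "idx z = 0 \<or> x (idx z - 1) \<le> Re z"
proof (rule ccontr)
  assume "\<not> ?thesis"
  then have "idx z \<noteq> 0" "Re z < x (idx z - 1)"
    by auto
  then have "idx z \<le> idx z - 1"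
    unfolding idx_def by (intro Least_le) auto
  with \<open>idx z \<noteq> 0\<close> show False by simp
qed

text \<open>With \<open>w = z - x n\<close>, the value \<open>1 + w\<^sup>2\<close> meets the branch
  cut only if \<open>Re w = 0\<close> and \<open>\<bar>Im w\<bar> \<ge> 1\<close>, that is, on the
  \<open>n\<close>-th slit.\<close>

lemma gate_holomorphic: "gate n holomorphic_on comb_domain x"
proof -
  have "1 + (z - of_real (x n))\<^sup>2 \<notin> \<real>\<^sub>\<le>\<^sub>0" if z: "z \<in> comb_domain x" for z
  proof
    define w where "w = z - of_real (x n)"
    assume "1 + (z - of_real (x n))\<^sup>2 \<in> \<real>\<^sub>\<le>\<^sub>0"
    then have re: "1 + (Re w)\<^sup>2 - (Im w)\<^sup>2 \<le> 0" and im: "Re w * Im w = 0"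
      unfolding w_def[symmetric] by (auto simp: complex_nonpos_Reals_iff Re_power2 Im_power2)
    have "Im w \<noteq> 0"
      using re by (smt (verit) zero_le_power2 zero_power2)
    then have "Re w = 0"
      using im by simp
    then have "1 \<le> (Im w)\<^sup>2"
      using re by simp
    then have "\<bar>Im w\<bar> \<ge> 1"
      using abs_square_less_1[of "Im w"] by simp
    moreover have "Re z = x n"
      using \<open>Re w = 0\<close> by (simp add: w_def)
    ultimately have "\<bar>Im z\<bar> \<ge> 1" "Re z = x n"
      by (auto simp: w_def)
    then show False
      using z by (fastforce simp: mem_comb_domain)
  qed
  moreover have "2 * x (Suc n) \<noteq> 0"
    using x_Suc_ge_1[of n] by simp
  then have "complex_of_real (2 * x (Suc n)) \<noteq> 0"
    by (simp only: of_real_eq_0_iff not_False_eq_True)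
  ultimately show ?thesis
    unfolding gate_def[abs_def] by (intro holomorphic_intros) auto
qed

lemma Re_gate:
  "Re (gate n z) = T n * (Re (csqrt (1 + (z - of_real (x n))\<^sup>2)) +
     cos ((Re z - x n) / (2 * x (Suc n))) * cosh (Im z / (2 * x (Suc n))))"
proof -
  have "Re (cos ((z - of_real (x n)) / of_real (2 * x (Suc n)))) =
      cos ((Re z - x n) / (2 * x (Suc n))) * cosh (Im z / (2 * x (Suc n)))"
    unfolding Re_cos Re_divide_of_real Im_divide_of_real by (simp add: cosh_def)
  then show ?thesis
    by (simp add: gate_def)
qed

text \<open>The divisor \<open>2 * x (Suc n)\<close> keeps the angle within \<open>[-1, 1]\<close>
  from the left edge of the comb up to slit \<open>Suc n\<close>, and
  \<open>1 < pi / 3\<close>.\<close>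

lemma gate_cos_ge_half:
  assumes "Re z > - x 1" "Re z \<le> x (Suc n)"
  shows "cos ((Re z - x n) / (2 * x (Suc n))) \<ge> 1/2"
proof (rule cos_ge_half)
  have "x n \<le> x (Suc n)" "x 1 \<le> x (Suc n)"
    by (auto intro!: monoD[OF strict_mono_mono[OF mono]])
  then show "\<bar>(Re z - x n) / (2 * x (Suc n))\<bar> \<le> 1"
    using assms x_Suc_ge_1[of n] x_nonneg[of n] by (simp add: abs_le_iff field_simps)
qed

text \<open>The cosine term alone: the factor 1/4 comes from \<open>cos \<ge> 1/2\<close> and
  \<open>cosh t \<ge> exp t / 2\<close>.\<close>

lemma gate_ge_exp:
  assumes "Re z > - x 1" "Re z \<le> x (Suc n)"
  shows "Re (gate n z) \<ge> T n / 4 * exp (\<bar>Im z\<bar> / (2 * x (Suc n)))"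
proof -
  define t where "t = \<bar>Im z\<bar> / (2 * x (Suc n))"
  have "cosh (Im z / (2 * x (Suc n))) = cosh t"
    using x_Suc_ge_1[of n] by (metis abs_divide abs_mult abs_numeral abs_of_nonneg cosh_real_abs t_def x_nonneg)
  also have "cosh t \<ge> exp t / 2"
    by (simp add: cosh_def)
  finally have "1/2 * (exp t / 2) \<le> cos ((Re z - x n) / (2 * x (Suc n))) * cosh (Im z / (2 * x (Suc n)))"
    using gate_cos_ge_half[OF assms] by (intro mult_mono) auto
  moreover have "0 \<le> Re (csqrt (1 + (z - of_real (x n))\<^sup>2))"
    by (rule Re_csqrt)
  ultimately have "T n * (exp t / 4) \<le> Re (gate n z)"
    unfolding Re_gate using T_pos[of n] by (intro mult_left_mono) (simp_all del: csqrt.sel)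
  then show ?thesis
    by (simp add: t_def)
qed

lemma gate_ge_dist:
  assumes "Re z > - x 1" "Re z \<le> x (Suc n)"
  shows "Re (gate n z) \<ge> T n * \<bar>Re z - x n\<bar>"
proof -
  have "\<bar>Re z - x n\<bar> \<le> Re (csqrt (1 + (z - of_real (x n))\<^sup>2))"
    using csqrt_one_plus_square_ge[of "z - of_real (x n)"] by simp
  moreover have "0 \<le> cos ((Re z - x n) / (2 * x (Suc n))) * cosh (Im z / (2 * x (Suc n)))"
    using gate_cos_ge_half[OF assms] by (intro mult_nonneg_nonneg) auto
  ultimately show ?thesis
    unfolding Re_gate using T_pos[of n] by (intro mult_left_mono) (simp_all del: csqrt.sel)
qed

text \<open>In the gap the root is \<open>sqrt (1 - (Im z)\<^sup>2) \<le> 1\<close>, the cosine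
  factor is \<open>cos 0 = 1\<close>, and the hyperbolic cosine is below
  \<open>(3 + 1) / 2\<close>.\<close>

lemma gate_less:
  assumes "Re z = x n" "\<bar>Im z\<bar> < 1"
  shows "Re (gate n z) < 3 * T n"
proof -
  have z: "z - of_real (x n) = \<i> * of_real (Im z)"
    using assms by (simp add: complex_eq_iff)
  have "(Im z)\<^sup>2 \<le> 1"
    using assms by (simp add: abs_square_le_1)
  have "1 + (z - of_real (x n))\<^sup>2 = of_real (1 - (Im z)\<^sup>2)"
    unfolding z by (simp add: power_mult_distrib)
  then have "csqrt (1 + (z - of_real (x n))\<^sup>2) = of_real (sqrt (1 - (Im z)\<^sup>2))"
    using \<open>(Im z)\<^sup>2 \<le> 1\<close> csqrt_of_real_nonneg[of "of_real (1 - (Im z)\<^sup>2)"]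
    by (metis Im_complex_of_real Re_complex_of_real diff_ge_0_iff_ge)
  then have "Re (csqrt (1 + (z - of_real (x n))\<^sup>2)) \<le> 1"
    by (simp del: csqrt.sel)
  moreover have "cosh (Im z / (2 * x (Suc n))) < 2"
  proof -
    define t where "t = \<bar>Im z / (2 * x (Suc n))\<bar>"
    have "t < 1"
      using assms x_Suc_ge_1[of n] by (simp add: t_def abs_mult field_simps)
    then have "exp t < exp 1"
      by simp
    also have "\<dots> \<le> 3"
      by (rule exp_le)
    finally have "exp t < 3" .
    moreover have "exp (- t) \<le> 1"
      by (simp add: t_def)
    ultimately have "exp t + exp (- t) < 4"
      by linarith
    then have "cosh t < 2"
      by (simp add: cosh_def)
    then show ?thesis
      unfolding t_def cosh_real_abs .
  qed
  ultimately show ?thesis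
    unfolding Re_gate using T_pos[of n] assms(1) by (simp del: csqrt.sel)
qed

text \<open>Compare \<open>gate_less\<close> with \<open>gate_ge_dist\<close> for the neighbours.
  For \<open>gate (n - 1)\<close> the point lies on the edge \<open>Re z = x n\<close> of the range
  where that bound holds.\<close>

lemma gate_less_neighbours:
  assumes z: "z \<in> comb_domain x" "Re z = x n" and n: "n \<ge> N"
  shows "Re (gate n z) < Re (gate (Suc n) z)"
    and "n > N \<Longrightarrow> Re (gate n z) < Re (gate (n - 1) z)"
proof -
  have le: "x n \<le> x (Suc n)" "x n \<le> x (Suc (Suc n))"
    by (auto intro!: monoD[OF strict_mono_mono[OF mono]])
  have re: "Re z > - x 1" and "\<bar>Im z\<bar> < 1"
    using z by (auto simp: mem_comb_domain)
  then have lt: "Re (gate n z) < 3 * T n"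
    using z by (intro gate_less) auto
  also have "3 * T n \<le> T (Suc n) * \<bar>Re z - x (Suc n)\<bar>"
    using T_down[OF n] le z by simp
  also have "\<dots> \<le> Re (gate (Suc n) z)"
    using re le z by (intro gate_ge_dist) auto
  finally show "Re (gate n z) < Re (gate (Suc n) z)" .
  assume "n > N"
  then obtain k where k: "n = Suc k" "k \<ge> N"
    by (cases n) auto
  note lt
  also have "3 * T n \<le> T k * (x n - x k)"
    using T_up[OF k(2)] k by simp
  also have "\<dots> \<le> T k * \<bar>Re z - x k\<bar>"
    using z T_pos[of k] by simp
  also have "\<dots> \<le> Re (gate k z)"
    using re z k by (intro gate_ge_dist) auto
  finally show "Re (gate n z) < Re (gate (n - 1) z)"
    using k by simp
qed

text \<open>Inside a strip \<open>idx\<close> is locally constant. On a slit line it takes two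
  values nearby, but from slit \<open>N\<close> on \<open>gate k\<close> is strictly the smallest
  candidate on either side, and stays so nearby by continuity.\<close>

lemma majorant_local:
  assumes a: "a \<in> comb_domain x"
  shows "\<exists>m m'. \<forall>\<^sub>F z in nhds a. majorant z = min (Re (gate m z)) (Re (gate m' z))"
proof (cases "idx a = 0 \<or> x (idx a - 1) < Re a")
  case True
  define n where "n = idx a"
  have "\<forall>\<^sub>F z in nhds a. Re z < x n"
    using idx_less[of a] unfolding n_def 
    by (intro order_tendstoD(2)[OF tendsto_Re[OF filterlim_ident]])
  moreover have "\<forall>\<^sub>F z in nhds a. n = 0 \<or> x (n - 1) \<le> Re z"
  proof (cases "n = 0")
    case False
    with True have "x (n - 1) < Re a"
      by (simp add: n_def)
    then have "\<forall>\<^sub>F z in nhds a. x (n - 1) < Re z"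
      by (intro order_tendstoD(1)[OF tendsto_Re[OF filterlim_ident]])
    then show ?thesis
      by eventually_elim simp
  qed auto
  ultimately have ev: "\<forall>\<^sub>F z in nhds a. idx z = n"
    by eventually_elim (rule idx_eqI)
  show ?thesis
  proof (cases "n \<le> N")
    case True
    have "\<forall>\<^sub>F z in nhds a. majorant z = min (Re (gate N z)) (Re (gate N z))"
      using ev by eventually_elim (use True in \<open>simp add: majorant_def\<close>)
    then show ?thesis by blast
  next
    case False
    have "\<forall>\<^sub>F z in nhds a. majorant z = min (Re (gate (n - 1) z)) (Re (gate n z))"
      using ev by eventually_elim (use False in \<open>simp add: majorant_def\<close>)
    then show ?thesis by blast
  qed
next
  case False
  then obtain k where k: "idx a = Suc k" "x k = Re a"
    using idx_ge[of a] by (cases "idx a") auto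
  have "\<forall>\<^sub>F z in nhds a. Re z < x (Suc k)"
    using idx_less[of a] unfolding k 
    by (intro order_tendstoD(2)[OF tendsto_Re[OF filterlim_ident]])
  moreover have "\<forall>\<^sub>F z in nhds a. k = 0 \<or> x (k - 1) \<le> Re z"
  proof (cases "k = 0")
    case False
    then have "x (k - 1) < x k"
      by (intro strict_monoD[OF mono]) auto
    then have "x (k - 1) < Re a"
      using k by simp
    then have "\<forall>\<^sub>F z in nhds a. x (k - 1) < Re z"
      by (intro order_tendstoD(1)[OF tendsto_Re[OF filterlim_ident]])
    then show ?thesis
      by eventually_elim simp
  qed auto
  ultimately have ev: "\<forall>\<^sub>F z in nhds a. idx z = k \<or> idx z = Suc k"
  proof eventually_elim
    case (elim z)
    then show ?case
      using idx_eqI[of z k] idx_eqI[of z "Suc k"] by (cases "Re z < x k") auto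
  qed
  show ?thesis
  proof (cases "Suc k \<le> N")
    case True
    have "\<forall>\<^sub>F z in nhds a. majorant z = min (Re (gate N z)) (Re (gate N z))"
      using ev by eventually_elim (use True in \<open>auto simp: majorant_def\<close>)
    then show ?thesis by blast
  next
    case False
    then have kN: "k \<ge> N" by simp
    have lt: "\<forall>\<^sub>F z in nhds a. Re (gate m z) < Re (gate m' z)"
      if "Re (gate m a) < Re (gate m' a)" for m m'
    proof -
      have "isCont (gate i) a" for i
        using holomorphic_on_imp_continuous_on[OF gate_holomorphic[of i]] a open_comb_domain[OF lim]
        by (simp add: continuous_on_eq_continuous_at)
      then have "isCont (\<lambda>z. Re (gate m' z) - Re (gate m z)) a"
        by (intro continuous_intros isCont_Re)
      then have "((\<lambda>z. Re (gate m' z) - Re (gate m z)) \<longlongrightarrow> Re (gate m' a) - Re (gate m a)) (nhds a)"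
        by (simp add: isCont_def tendsto_nhds_iff)
      then have "\<forall>\<^sub>F z in nhds a. 0 < Re (gate m' z) - Re (gate m z)"
        by (rule order_tendstoD(1)) (use that in simp)
      then show ?thesis
        by eventually_elim simp
    qed
    have right: "\<forall>\<^sub>F z in nhds a. Re (gate k z) < Re (gate (Suc k) z)"
      using gate_less_neighbours(1)[OF a _ kN] k by (intro lt) simp
    have left: "\<forall>\<^sub>F z in nhds a. k > N \<longrightarrow> Re (gate k z) < Re (gate (k - 1) z)"
    proof (cases "k > N")
      case True
      then have "\<forall>\<^sub>F z in nhds a. Re (gate k z) < Re (gate (k - 1) z)"
        using gate_less_neighbours(2)[OF a _ kN] k by (intro lt) simp
      then show ?thesis
        by eventually_elim simp
    qed simp
    have "\<forall>\<^sub>F z in nhds a. majorant z = min (Re (gate k z)) (Re (gate k z))"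
      using ev right left
    proof eventually_elim
      case (elim z)
      show ?case
      proof (cases "idx z = k")
        case True
        then show ?thesis
          \<comment> \<open>For \<open>k = N\<close> the left side carries \<open>gate N\<close> by
            definition; for \<open>k > N\<close> the comparison \<open>left\<close> decides.\<close>
          using elim kN by (cases "k = N") (auto simp: majorant_def)
      next
        case False
        then have "idx z = Suc k"
          using elim by blast
        then show ?thesis
          using elim kN by (auto simp: majorant_def)
      qed
    qed
    then show ?thesis by blast
  qed
qed

lemma harmonically_supported_majorant: "harmonically_supported majorant (comb_domain x)"
proof (rule harmonically_supported_min)
  fix a assume a: "a \<in> comb_domain x"
  obtain m m' where ev: "\<forall>\<^sub>F z in nhds a. majorant z = min (Re (gate m z)) (Re (gate m' z))"
    using majorant_local[OF a] by blast
  have "\<forall>\<^sub>F z in nhds a. z \<in> comb_domain x"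
    using open_comb_domain[OF lim] a by (rule eventually_nhds_in_open)
  with ev have "\<forall>\<^sub>F z in nhds a. z \<in> comb_domain x \<and> majorant z = min (Re (gate m z)) (Re (gate m' z))"
    by eventually_elim simp
  then obtain e where e: "e > 0"
    "\<And>z. dist z a < e \<Longrightarrow> z \<in> comb_domain x \<and> majorant z = min (Re (gate m z)) (Re (gate m' z))"
    unfolding eventually_nhds_metric by blast
  then have "ball a e \<subseteq> comb_domain x"
    by (auto simp: dist_commute)
  then show "\<exists>g h e. e > 0 \<and> ball a e \<subseteq> comb_domain x \<and> g holomorphic_on ball a e \<and>
     h holomorphic_on ball a e \<and> (\<forall>z\<in>ball a e. majorant z = min (Re (g z)) (Re (h z)))"
    using e holomorphic_on_subset[OF gate_holomorphic]
    by (intro exI[of _ "gate m"] exI[of _ "gate m'"] exI[of _ e]) (auto simp: dist_commute)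
qed

text \<open>Whichever gate attains the minimum, \<open>z\<close> lies in the range where its lower
  bounds hold.\<close>

lemma majorant_eq_gate:
  obtains n where "n \<ge> N" "Re z \<le> x (Suc n)" "majorant z = Re (gate n z)"
proof -
  obtain n where n: "n \<ge> N" "idx z \<le> Suc n" "majorant z = Re (gate n z)"
  proof (cases "idx z \<le> N")
    case True
    then show ?thesis
      by (intro that[of N]) (auto simp: majorant_def)
  next
    case False
    then have "majorant z = min (Re (gate (idx z - 1) z)) (Re (gate (idx z) z))"
      by (simp add: majorant_def)
    then show ?thesis
      using False that[of "idx z - 1"] that[of "idx z"] by (auto simp: min_def split: if_splits)
  qed
  have "x (idx z) \<le> x (Suc n)"
    using n by (intro monoD[OF strict_mono_mono[OF mono]])
  then show thesis
    using n idx_less[of z] by (intro that[of n]) auto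
qed

text \<open>With \<open>X = x (Suc n)\<close> and \<open>\<bar>Im z\<bar> = 2 * X * t\<close>, the
  norm is at most \<open>2 * X * (1 + t)\<close>. The weight absorbs \<open>X powr p\<close>, the
  exponential absorbs \<open>(1 + t) powr p\<close>, and 4 offsets the 1/4 in
  \<open>gate_ge_exp\<close>.\<close>

lemma powr_le_majorant:
  assumes p: "p > 0" and T: "\<And>n. n \<ge> N \<Longrightarrow> x (Suc n) powr p \<le> T n" and z: "z \<in> comb_domain x"
  shows "norm z powr p \<le> 4 * 2 powr p * max 1 p powr p * majorant z"
proof -
  obtain n where n: "n \<ge> N" "Re z \<le> x (Suc n)" "majorant z = Re (gate n z)"
    by (rule majorant_eq_gate)
  define X where "X = x (Suc n)"
  define t where "t = \<bar>Im z\<bar> / (2 * X)"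
  have X: "X \<ge> 1"
    using x_Suc_ge_1 by (simp add: X_def)
  have t: "t \<ge> 0" "\<bar>Im z\<bar> = 2 * X * t"
    using X by (auto simp: t_def)
  have re: "Re z > - x 1"
    using z by (simp add: mem_comb_domain)
  have "x 1 \<le> X"
    unfolding X_def by (auto intro!: monoD[OF strict_mono_mono[OF mono]])
  then have "\<bar>Re z\<bar> \<le> X"
    using n re by (simp add: X_def)
  then have "norm z \<le> 2 * X * (1 + t)"
    using cmod_le[of z] X t by (simp add: algebra_simps)
  then have "norm z powr p \<le> (2 * X * (1 + t)) powr p"
    using p by (intro powr_mono2) auto
  also have "\<dots> = 2 powr p * X powr p * (1 + t) powr p"
    using X t by (simp add: powr_mult)
  also have "\<dots> \<le> 2 powr p * T n * (max 1 p powr p * exp t)"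
    using T[OF n(1)] T_pos[of n] one_plus_powr_le_exp[OF p t(1)]
    by (intro mult_mono) (auto simp: X_def)
  also have "\<dots> = 4 * 2 powr p * max 1 p powr p * (T n / 4 * exp t)"
    by simp
  also have "\<dots> \<le> 4 * 2 powr p * max 1 p powr p * majorant z"
    using gate_ge_exp[OF re n(2)] unfolding n(3) t_def X_def by (intro mult_left_mono) auto
  finally show ?thesis .
qed

end

section \<open>Choice of the weights and verification of their growth\<close>

theorem theorem1p3:
  fixes x \<alpha> b :: "nat \<Rightarrow> real"
  assumes x_0: "x 0 = 0"
    and x_pos: "\<And>n. n \<ge> 1 \<Longrightarrow> x n > 0"
    and x_strict_mono: "strict_mono_on {1..} x"
    and x_lim: "filterlim x at_top sequentially"
    and x_gaps: "(INF n\<in>{1..}. x n - x (n - 1)) > 1"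
    and \<alpha>_eq: "\<And>n. n \<ge> 1 \<Longrightarrow> \<alpha> n = x n - x (n - 1)"
    and b_pos: "\<And>n. n \<ge> 1 \<Longrightarrow> b n > 0"
    and b_mono: "mono_on {1..} b"
    and b_gaps: "(INF n\<in>{1<..}. b n - b (n - 1)) > 0"
    and \<alpha>_le: "\<And>n. n \<ge> 1 \<Longrightarrow> \<alpha> n \<le> exp (b n)"
    and lim: "filterlim (\<lambda>n. ln (\<alpha> n) / (b n - b (n - 1))) at_top sequentially"
  shows "hardy_number (comb_domain x) = \<infinity>"
proof (rule hardy_number_eq_infinity)
  have x_less: "x n < x (Suc n)" for n
    using x_0 x_pos[of "Suc n"] strict_mono_onD[OF x_strict_mono, of n "Suc n"] by (cases n) auto
  then have x_mono: "strict_mono x"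
    by (simp add: strict_mono_Suc_iff)
  have x_1: "x 1 > 1"
  proof -
    \<comment> \<open>A real infimum is known to be a lower bound only for a family bounded
      below.\<close>
    have "x n - x (n - 1) \<ge> 0" if "n \<ge> 1" for n
      using x_less[of "n - 1"] that by simp
    then have "bdd_below ((\<lambda>n. x n - x (n - 1)) ` {1..})"
      by (intro bdd_belowI2[of _ 0]) auto
    from cINF_lower[OF this, of 1] show ?thesis
      using x_gaps x_0 by simp
  qed
  show "\<exists>f. riemann_map_onto f (comb_domain x)"
  proof (rule riemann_map_onto_exists)
    show "open (comb_domain x)"
      by (rule open_comb_domain[OF x_lim])
    show "simply_connected (comb_domain x)"
      using x_1 by (intro contractible_imp_simply_connected contractible_comb_domain) simp
    have "0 \<in> comb_domain x" "of_real (- x 1) \<notin> comb_domain x"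
      using x_1 by (auto simp: mem_comb_domain)
    then show "comb_domain x \<noteq> {}" "comb_domain x \<noteq> UNIV"
      by auto
  qed
  fix f :: "complex \<Rightarrow> complex" and p :: real
  assume f: "riemann_map_onto f (comb_domain x)" and p: "p > 0"
  define \<delta> where "\<delta> = (INF n\<in>{1<..}. b n - b (n - 1))"
  have \<delta>: "\<delta> > 0"
    using b_gaps by (simp add: \<delta>_def)
  have gap: "b n + \<delta> \<le> b (Suc n)" if "n \<ge> 1" for n
  proof -
    have "bdd_below ((\<lambda>n. b n - b (n - 1)) ` {1<..})"
    proof (rule bdd_belowI2[of _ 0])
      fix n :: nat assume "n \<in> {1<..}"
      then show "0 \<le> b n - b (n - 1)"
        using mono_onD[OF b_mono, of "n - 1" n] by auto
    qed
    from cINF_lower[OF this, of "Suc n"] show ?thesis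
      using that by (simp add: \<delta>_def)
  qed
  have b_ge: "\<delta> * (real n - 1) \<le> b n" if "n \<ge> 1" for n
    using that
  proof (induction n rule: nat_induct_at_least)
    case base
    then show ?case
      using b_pos[of 1] by simp
  next
    case (Suc n)
    then show ?case
      using gap[of n] by (simp add: algebra_simps)
  qed
  \<comment> \<open>\<open>x n\<close> is a sum of \<open>n\<close> gaps, each at most
    \<open>exp (b n)\<close>; linear growth of \<open>b\<close> turns the factor \<open>n\<close>
    into \<open>exp (b n / \<delta>)\<close>.\<close>
  have x_le: "x n \<le> exp ((1 + 1 / \<delta>) * b n)" if "n \<ge> 1" for n
  proof -
    have "x n \<le> real n * exp (b n)"
      using that
    proof (induction n rule: nat_induct_at_least)
      case base
      then show ?case
        using \<alpha>_le[of 1] \<alpha>_eq[of 1] x_0 by simp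
    next
      case (Suc n)
      have "real n * exp (b n) \<le> real n * exp (b (Suc n))"
        using gap[of n] Suc \<delta> by (intro mult_left_mono) auto
      with Suc.IH have "x n \<le> real n * exp (b (Suc n))"
        by linarith
      then show ?case
        using \<alpha>_le[of "Suc n"] \<alpha>_eq[of "Suc n"] by (simp add: algebra_simps)
    qed
    also have "real n \<le> exp (b n / \<delta>)"
    proof -
      have "real n \<le> 1 + b n / \<delta>"
        using b_ge[OF that] \<delta> by (simp add: field_simps)
      also have "\<dots> \<le> exp (b n / \<delta>)"
        by (rule exp_ge_add_one_self)
      finally show ?thesis .
    qed
    finally show ?thesis
      by (simp add: algebra_simps flip: exp_add)
  qed
  \<comment> \<open>\<open>1 + 1 / \<delta>\<close> is the exponent in \<open>x_le\<close>, and 2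
    allows for \<open>b (Suc n) \<le> 2 * b n\<close>; thus \<open>T n\<close> will dominate
    \<open>x (Suc n) powr p\<close>.\<close>
  define q where "q = 2 * p * (1 + 1 / \<delta>)"
  have q: "q > 0"
    using p \<delta> by (simp add: q_def add_pos_pos)
  define T where "T n = exp (q * b n)" for n
  \<comment> \<open>The threshold 2 yields \<open>b (Suc n) \<le> 2 * b n\<close>. The other yields
    \<open>T_up\<close>, where \<open>ln 3 / \<delta>\<close> covers the factor 3 because
    \<open>b\<close> increases by at least \<open>\<delta>\<close>.\<close>
  obtain N where N: "N \<ge> 1" "\<And>n. n \<ge> N \<Longrightarrow> max 2 (q + ln 3 / \<delta>) \<le> ln (\<alpha> n) / (b n - b (n - 1))"
  proof -
    obtain N where N: "\<And>n. n \<ge> N \<Longrightarrow> max 2 (q + ln 3 / \<delta>) \<le> ln (\<alpha> n) / (b n - b (n - 1))"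
      using lim unfolding filterlim_at_top eventually_sequentially by blast
    show thesis
      by (rule that[of "max N 1"]) (use N in auto)
  qed
  have ln_ge: "c * (b (Suc n) - b n) \<le> ln (\<alpha> (Suc n))"
    if "n \<ge> N" "c \<le> max 2 (q + ln 3 / \<delta>)" for n c
  proof -
    have "b (Suc n) - b n > 0"
      using gap[of n] \<delta> N(1) that by simp
    moreover have "c \<le> ln (\<alpha> (Suc n)) / (b (Suc n) - b n)"
      using order_trans[OF that(2) N(2)[of "Suc n"]] that(1) by simp
    ultimately show ?thesis
      by (simp add: pos_le_divide_eq)
  qed
  have \<alpha>_pos: "\<alpha> (Suc n) > 0" for n
    using \<alpha>_eq[of "Suc n"] x_less[of n] by simp
  have T_up: "3 * T (Suc n) \<le> T n * \<alpha> (Suc n)" if n: "n \<ge> N" for n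
  proof -
    have "ln 3 \<le> ln 3 / \<delta> * (b (Suc n) - b n)"
    proof -
      have "ln 3 / \<delta> * \<delta> \<le> ln 3 / \<delta> * (b (Suc n) - b n)"
        using gap[of n] n N(1) \<delta> by (intro mult_left_mono) auto
      then show ?thesis
        using \<delta> by simp
    qed
    then have "ln 3 + q * (b (Suc n) - b n) \<le> ln (\<alpha> (Suc n))"
      using ln_ge[OF n, of "q + ln 3 / \<delta>"] by (simp add: algebra_simps)
    then have "ln 3 + q * b (Suc n) \<le> q * b n + ln (\<alpha> (Suc n))"
      by (simp add: algebra_simps)
    then have "exp (ln 3 + q * b (Suc n)) \<le> exp (q * b n + ln (\<alpha> (Suc n)))"
      by simp
    then show ?thesis
      using \<alpha>_pos[of n] by (simp add: T_def exp_add)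
  qed
  have T_mono: "T n \<le> T (Suc n)" if "n \<ge> N" for n
    using gap[of n] that N(1) \<delta> q by (simp add: T_def)
  interpret comb_weights x T N
  proof
    fix n assume n: "n \<ge> N"
    show "3 * T (Suc n) \<le> T n * (x (Suc n) - x n)"
      using T_up[OF n] \<alpha>_eq[of "Suc n"] by simp
    \<comment> \<open>As \<open>T\<close> increases, \<open>T_up\<close> already forces
      \<open>\<alpha> (Suc n) \<ge> 3\<close>, which gives the reverse condition.\<close>
    have "T n * 3 \<le> T n * \<alpha> (Suc n)"
      using T_up[OF n] T_mono[OF n] by simp
    then have "3 \<le> \<alpha> (Suc n)"
      by (rule mult_left_le_imp_le) (simp add: T_def)
    then have "T n * 3 \<le> T (Suc n) * \<alpha> (Suc n)"
      using T_mono[OF n] by (intro mult_mono) (auto simp: T_def)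
    then show "3 * T n \<le> T (Suc n) * (x (Suc n) - x n)"
      using \<alpha>_eq[of "Suc n"] by simp
  qed (use x_mono x_0 x_1 x_lim in \<open>auto simp: T_def\<close>)
  have "x (Suc n) powr p \<le> T n" if n: "n \<ge> N" for n
  proof -
    \<comment> \<open>Here \<open>\<alpha> \<le> exp b\<close> enters: \<open>2 * (b (Suc n) - b n)
      \<le> ln (\<alpha> (Suc n)) \<le> b (Suc n)\<close>.\<close>
    have "ln (\<alpha> (Suc n)) \<le> ln (exp (b (Suc n)))"
      using \<alpha>_le[of "Suc n"] \<alpha>_pos[of n] by (intro ln_mono) auto
    then have "b (Suc n) \<le> 2 * b n"
      using ln_ge[OF n, of 2] by simp
    then have "(1 + 1 / \<delta>) * b (Suc n) \<le> (1 + 1 / \<delta>) * (2 * b n)"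
      using \<delta> by (intro mult_left_mono) auto
    then have "exp ((1 + 1 / \<delta>) * b (Suc n)) \<le> exp ((1 + 1 / \<delta>) * (2 * b n))"
      by (simp only: exp_le_cancel_iff)
    with x_le[of "Suc n"] have "x (Suc n) \<le> exp ((1 + 1 / \<delta>) * (2 * b n))"
      by linarith
    then have "x (Suc n) powr p \<le> exp ((1 + 1 / \<delta>) * (2 * b n)) powr p"
      using p x_pos[of "Suc n"] by (intro powr_mono2) auto
    also have "\<dots> = T n"
      by (simp add: exp_powr_real T_def q_def algebra_simps)
    finally show ?thesis .
  qed
  then have le: "norm z powr p \<le> 4 * 2 powr p * max 1 p powr p * majorant z" if "z \<in> comb_domain x" for z
    using p that by (intro powr_le_majorant)
  show "f \<in> hardy_space p"
  proof (rule in_hardy_spaceI[OF _ _ harmonically_supported_majorant p le])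
    show "f holomorphic_on ball 0 1" "f ` ball 0 1 \<subseteq> comb_domain x"
      using f by (auto simp: riemann_map_onto_def bij_betw_def)
    show "0 < 4 * 2 powr p * max 1 p powr p"
      using p by simp
  qed
qed

end
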